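(* Let $\mathcal{A}$ be a commutative unital C*-algebra. Then the matrix $$\left[\left(\prod_{l=1}^{d}\frac{1+\cos(x_{j,l}-x_{k,l})}{2}\right)-\frac1n\right]_{1\le j,k\le n}\in M_n(\mathcal{A})$$ is positive for all $n,d\ge 2$ and all choices of $x_j=(x_{j,1},\dots,x_{j,d})\in\mathcal{A}_{\mathrm{sa}}^d$, $1\le j\le n$.
   Context: $\mathcal{A}_{\mathrm{sa}}$ is the set of self-adjoint elements of $\mathcal{A}$. Scalars such as $1$ and $\frac1n$ are identified with multiples of the unit of $\mathcal{A}$. The exponential is $e^x=\sum_{m=0}^\infty \frac{x^m}{m!}$ for $x\in\mathcal{A}$, and the C*-algebraic cosine is $\cos x=\frac{e^{ix}+e^{-ix}}{2}\in\mathcal{A}$. $M_n(\mathcal{A})$ is the *-algebra of $n\times n$ matrices over $\mathcal{A}$ with involution $[a_{j,k}]^*=[a_{k,j}^*]$. On $\mathcal{A}^n$ (column vectors) use the $\mathcal{A}$-valued inner product $\langle (x_j)_{j=1}^n,(y_j)_{j=1}^n\rangle=\sum_{j=1}^n x_jy_j^*$. A matrix $A\in M_n(\mathcal{A})$ is called positive if $A=A^*$ and $\langle Ax,x\rangle\ge 0$ in $\mathcal{A}$ for all $x\in\mathcal{A}^n$. *)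

theory Defs
  imports Complex_Main "Jordan_Normal_Form.Matrix"
begin

text \<open>
  Unital C*-algebras as a type class over the real Banach algebra classes, so that the library's
  \<^const>\<open>exp\<close> (the power series) is available. The class \<^class>\<open>real_normed_algebra_1\<close> makes the
  algebra nonzero.
\<close>

class cstar_algebra = real_normed_algebra_1 + banach +
  fixes scaleC :: "complex \<Rightarrow> 'a \<Rightarrow> 'a"  (infixr "*\<^sub>C" 75)
    and star :: "'a \<Rightarrow> 'a"
  assumes scaleC_add_right: "c *\<^sub>C (x + y) = c *\<^sub>C x + c *\<^sub>C y"
    and scaleC_add_left: "(b + c) *\<^sub>C x = b *\<^sub>C x + c *\<^sub>C x"
    and scaleC_scaleC: "b *\<^sub>C c *\<^sub>C x = (b * c) *\<^sub>C x"
    and scaleC_one: "1 *\<^sub>C x = x"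
    and scaleR_scaleC: "r *\<^sub>R x = complex_of_real r *\<^sub>C x"
    and mult_scaleC_left: "(c *\<^sub>C x) * y = c *\<^sub>C (x * y)"
    and mult_scaleC_right: "x * (c *\<^sub>C y) = c *\<^sub>C (x * y)"
    and norm_scaleC: "norm (c *\<^sub>C x) = cmod c * norm x"
    and star_star: "star (star x) = x"
    and star_add: "star (x + y) = star x + star y"
    and star_scaleC: "star (c *\<^sub>C x) = cnj c *\<^sub>C star x"
    and star_mult: "star (x * y) = star y * star x"
    and cstar_identity: "norm (star x * x) = (norm x)\<^sup>2"

class comm_cstar_algebra = cstar_algebra + comm_ring_1

instantiation complex :: comm_cstar_algebra
begin

definition scaleC_complex :: "complex \<Rightarrow> complex \<Rightarrow> complex" where
  "scaleC_complex c x = c * x"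

definition star_complex :: "complex \<Rightarrow> complex" where
  "star_complex x = cnj x"

instance
  by standard
    (simp_all add: scaleC_complex_def star_complex_def algebra_simps norm_mult power2_eq_square
      scaleR_conv_of_real)

end

definition self_adjoint :: "'a::cstar_algebra set" where
  "self_adjoint = {a. star a = a}"

definition alg_spectrum :: "'a::cstar_algebra \<Rightarrow> complex set" where
  "alg_spectrum a = {z. \<not> (\<exists>b. (a - z *\<^sub>C 1) * b = 1 \<and> b * (a - z *\<^sub>C 1) = 1)}"

text \<open>The relation \<open>a \<ge> 0\<close> of the algebra: self-adjoint with spectrum in the nonnegative reals.\<close>

definition cstar_nonneg :: "'a::cstar_algebra \<Rightarrow> bool" where
  "cstar_nonneg a \<longleftrightarrow> a \<in> self_adjoint \<and> alg_spectrum a \<subseteq> complex_of_real ` {0..}"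

definition cstar_cos :: "'a::cstar_algebra \<Rightarrow> 'a" where
  "cstar_cos x = (1/2) *\<^sub>R (exp (\<i> *\<^sub>C x) + exp (- (\<i> *\<^sub>C x)))"

definition mat_star :: "'a::cstar_algebra mat \<Rightarrow> 'a mat" where
  "mat_star A = mat (dim_col A) (dim_row A) (\<lambda>(j, k). star (A $$ (k, j)))"

definition inner_vec :: "'a::cstar_algebra vec \<Rightarrow> 'a vec \<Rightarrow> 'a" where
  "inner_vec x y = (\<Sum>j<dim_vec y. x $ j * star (y $ j))"

definition positive_mat :: "nat \<Rightarrow> 'a::cstar_algebra mat \<Rightarrow> bool" where
  "positive_mat n A \<longleftrightarrow> A \<in> carrier_mat n n \<and> mat_star A = A \<and>
     (\<forall>x\<in>carrier_vec n. cstar_nonneg (inner_vec (A *\<^sub>v x) x))"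

end

theory Submission
  imports Defs
begin

text \<open>
  Since $(1+\cos t)/2=\cos^2(t/2)$ and
  $\cos(a-b)=\cos a\cos b+\sin a\sin b$, the product in the matrix is the entrywise square of
  $K_{jk}=\prod_l\cos((x_{j,l}-x_{k,l})/2)$, a product of Gram kernels, with $K_{jj}=1$. So the
  claim is an instance of a sharpened Schur product theorem: for a Gram kernel $K$ on $n$ points,
  $(K_{jk}^2)_{jk}\ge\frac1n(K_{jj}K_{kk})_{jk}$.

  For real kernels this is a Cauchy-Schwarz inequality for a trace. Write $K_{jk}$ as the inner product
  of vectors $v_j$ that lie in a space of dimension $n$, which is possible because $n$ vectors span
  no more. For coefficients $c_j$ let $T=\sum_j c_j v_jv_j^*$. The quadratic form of $(K_{jk}^2)$
  at $c$ is the squared Hilbert-Schmidt norm of $T$, the sum $\sum_j c_jK_{jj}$ is its trace, and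
  for an $n\times n$ matrix $|\mathrm{tr}\,T|^2\le n\|T\|_{HS}^2$.

  This argument is carried out inside the algebra, with sums of squares of self-adjoint elements
  in place of nonnegative numbers. Two points make it work.

  First, sums of squares have nonnegative spectrum. For self-adjoint $h$ and real
  $t>0$ the element $w=t-h^2+i\sqrt{2t}\,h$ satisfies $w^*w=t^2+h^4$, so the C*-identity bounds
  $\|t-h^2\|\le\|w\|$ by $t+O(1/t)$. The same bound passes to sums of squares, and to
  limits of these up to an arbitrarily small error; then a Neumann series inverts $a+r$ for every
  real $r>0$ (\<open>invertible_if_near_sum_of_squares\<close>,
  \<open>cstar_nonneg_if_limit_of_sums_of_squares\<close>).

  Second, passing to $n$ dimensions is an LDL decomposition, which divides by pivots. Adding
  $e>0$ to the diagonal makes each pivot a sum of squares plus $e$, hence invertible, and the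
  Schur complement of a Gram kernel shifted in this way is again such a kernel
  (\<open>gram_kernel_LDL\<close>). The quadratic form of the shifted kernel is then a sum
  of squares (\<open>schur_square_form_sum_of_squares\<close>), and $e\to0$ gives the theorem.
\<close>

section \<open>Calculus in C*-algebras\<close>

text \<open>
  Multiplication by $i$ as multiplication by a fixed element, so that the ring simplification
  rules apply to expressions that mix it with products.
\<close>

definition imag_unit :: "'a::cstar_algebra" where
  "imag_unit = \<i> *\<^sub>C 1"

lemma scaleC_i: "\<i> *\<^sub>C x = imag_unit * x"
  for x :: "'a::cstar_algebra"
  by (simp add: imag_unit_def mult_scaleC_left)

lemma imag_unit_square: "imag_unit * imag_unit = (-1 :: 'a::cstar_algebra)"
proof -
  have "imag_unit * imag_unit = (\<i> * \<i>) *\<^sub>C (1::'a)"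
    by (simp add: imag_unit_def mult_scaleC_left scaleC_scaleC)
  also have "\<dots> = complex_of_real (-1) *\<^sub>C (1::'a)" by simp
  also have "\<dots> = -1" by (subst scaleR_scaleC[symmetric]) simp
  finally show ?thesis .
qed

lemma star_scaleR: "star (r *\<^sub>R x) = r *\<^sub>R star x" for x :: "'a::cstar_algebra"
  by (simp add: scaleR_scaleC star_scaleC)

lemma star_zero [simp]: "star (0::'a::cstar_algebra) = 0"
  using star_scaleR[of 0 "0::'a"] by simp

lemma star_minus: "star (- x) = - star x" for x :: "'a::cstar_algebra"
  using star_scaleR[of "-1" x] by simp

lemma star_diff: "star (x - y) = star x - star y" for x y :: "'a::cstar_algebra"
  using star_add[of x "- y"] by (simp add: star_minus)

lemma star_one [simp]: "star (1::'a::cstar_algebra) = 1"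
  using star_mult[of "star (1::'a)" 1] by (simp add: star_star)

lemma star_of_real [simp]: "star (of_real r :: 'a::cstar_algebra) = of_real r"
  unfolding of_real_def star_scaleR star_one by (rule refl)

lemma star_imag_unit: "star imag_unit = (- imag_unit :: 'a::cstar_algebra)"
proof -
  have "star imag_unit = (- 1 * \<i>) *\<^sub>C (1::'a)"
    by (simp add: imag_unit_def star_scaleC)
  also have "\<dots> = complex_of_real (-1) *\<^sub>C (imag_unit::'a)"
    by (simp only: scaleC_scaleC[symmetric] imag_unit_def) simp
  also have "\<dots> = - imag_unit" by (subst scaleR_scaleC[symmetric]) simp
  finally show ?thesis .
qed

lemma star_sum: "star (\<Sum>i\<in>A. f i) = (\<Sum>i\<in>A. star (f i))"
  for f :: "'i \<Rightarrow> 'a::cstar_algebra"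
  by (induction A rule: infinite_finite_induct) (simp_all add: star_add)

lemma norm_star: "norm (star x) = norm x" for x :: "'a::cstar_algebra"
proof -
  have le: "norm y \<le> norm (star y)" for y :: 'a
  proof (cases "y = 0")
    case False
    have "norm y * norm y \<le> norm (star y) * norm y"
      using norm_mult_ineq[of "star y" y] by (simp add: cstar_identity power2_eq_square)
    then show ?thesis using False by simp
  qed simp
  show ?thesis using le[of x] le[of "star x"] by (simp add: star_star)
qed

lemma star_exp: "star (exp x) = exp (star x)" for x :: "'a::cstar_algebra"
proof -
  have lin: "bounded_linear (star :: 'a \<Rightarrow> 'a)"
    by (rule bounded_linear_intro[where K = 1]) (simp_all add: star_add star_scaleR norm_star)
  have pow: "star (x ^ m) = star x ^ m" for m
    by (induction m) (simp_all add: star_mult power_commutes)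
  have "(\<lambda>m. star (x ^ m /\<^sub>R fact m)) sums star (exp x)"
    by (rule bounded_linear.sums[OF lin exp_converges])
  then have "(\<lambda>m. star x ^ m /\<^sub>R fact m) sums star (exp x)"
    by (simp add: star_scaleR pow)
  then show ?thesis using exp_converges sums_unique2 by blast
qed

lemma self_adjointD: "x \<in> self_adjoint \<Longrightarrow> star x = x"
  by (simp add: self_adjoint_def)

lemma self_adjoint_intros [intro, simp]:
  fixes x y :: "'a::comm_cstar_algebra"
  shows "0 \<in> (self_adjoint :: 'a set)"
    and "1 \<in> (self_adjoint :: 'a set)"
    and "of_real r \<in> (self_adjoint :: 'a set)"
    and "x \<in> self_adjoint \<Longrightarrow> y \<in> self_adjoint \<Longrightarrow> x + y \<in> self_adjoint"
    and "x \<in> self_adjoint \<Longrightarrow> y \<in> self_adjoint \<Longrightarrow> x - y \<in> self_adjoint"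
    and "x \<in> self_adjoint \<Longrightarrow> y \<in> self_adjoint \<Longrightarrow> x * y \<in> self_adjoint"
    and "x \<in> self_adjoint \<Longrightarrow> r *\<^sub>R x \<in> self_adjoint"
  by (auto simp: self_adjoint_def star_add star_diff star_mult star_scaleR mult.commute)

definition re_part :: "'a::cstar_algebra \<Rightarrow> 'a" where
  "re_part c = (1/2) *\<^sub>R (c + star c)"

definition im_part :: "'a::cstar_algebra \<Rightarrow> 'a" where
  "im_part c = (1/2) *\<^sub>R (imag_unit * (star c - c))"

lemma re_part_self_adjoint: "re_part c \<in> self_adjoint"
  for c :: "'a::cstar_algebra"
  by (simp add: re_part_def self_adjoint_def star_scaleR star_add star_star add.commute)

lemma im_part_self_adjoint: "im_part c \<in> self_adjoint"
  for c :: "'a::comm_cstar_algebra"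
  by (simp add: im_part_def self_adjoint_def star_scaleR star_diff star_star star_mult
      star_imag_unit algebra_simps)

text \<open>
  The addition formula for the cosine of a difference, in exponential form: for unitaries $z$ and
  $w$ with arguments $a$ and $b$ it reads $\cos(a-b)=\cos a\cos b+\sin a\sin b$. It exhibits
  the left-hand side, as a kernel in $z$ and $w$, as a Gram kernel.
\<close>

lemma re_part_mult_star:
  fixes z w :: "'a::comm_cstar_algebra"
  shows "re_part (z * star w) = re_part z * re_part w + im_part z * im_part w"
proof -
  have "im_part z * im_part w
      = (1/4) *\<^sub>R ((imag_unit * imag_unit) * ((star z - z) * (star w - w)))"
    by (simp add: im_part_def algebra_simps)
  also have "\<dots> = - ((1/4) *\<^sub>R ((star z - z) * (star w - w)))"
    by (simp add: imag_unit_square)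
  finally have im: "im_part z * im_part w = - ((1/4) *\<^sub>R ((star z - z) * (star w - w)))" .
  \<comment> \<open>Halving the outer factor once more puts both sides over the common denominator 4.\<close>
  have two: "(1/2) *\<^sub>R a = (1/4) *\<^sub>R a + (1/4) *\<^sub>R a" for a :: 'a
    by (simp flip: scaleR_left_distrib)
  show ?thesis
    unfolding im re_part_def two[of "z * star w + _"]
    by (simp add: star_mult star_star algebra_simps)
qed

section \<open>Sums of squares are nonnegative\<close>

inductive sum_of_squares :: "'a::comm_cstar_algebra \<Rightarrow> bool" where
  zero: "sum_of_squares 0"
| add_square: "sum_of_squares a \<Longrightarrow> h \<in> self_adjoint \<Longrightarrow> sum_of_squares (a + h * h)"

lemma sum_of_squares_square: "h \<in> self_adjoint \<Longrightarrow> sum_of_squares (h * h)"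
  using add_square[OF zero] by simp

lemma sum_of_squares_self_adjoint: "sum_of_squares a \<Longrightarrow> a \<in> self_adjoint"
  by (induction rule: sum_of_squares.induct) auto

lemma sum_of_squares_add: "sum_of_squares b \<Longrightarrow> sum_of_squares a \<Longrightarrow> sum_of_squares (a + b)"
proof (induction rule: sum_of_squares.induct)
  case (add_square b h)
  then show ?case using sum_of_squares.add_square[of "a + b" h] by (simp add: add.assoc)
qed simp

text \<open>
  Here commutativity enters: $g^2h^2=(gh)^2$ with $gh$ self-adjoint.
\<close>

lemma sum_of_squares_mult_square:
  "sum_of_squares a \<Longrightarrow> h \<in> self_adjoint \<Longrightarrow> sum_of_squares (a * (h * h))"
proof (induction rule: sum_of_squares.induct)
  case (add_square a g)
  have "(a + g * g) * (h * h) = a * (h * h) + (g * h) * (g * h)" by (simp add: algebra_simps)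
  then show ?case using sum_of_squares.add_square[of "a * (h * h)" "g * h"] add_square by simp
qed (simp add: zero)

lemma sum_of_squares_mult: "sum_of_squares b \<Longrightarrow> sum_of_squares a \<Longrightarrow> sum_of_squares (a * b)"
proof (induction rule: sum_of_squares.induct)
  case (add_square b h)
  then have "sum_of_squares (a * b + a * (h * h))"
    by (intro sum_of_squares_add[OF sum_of_squares_mult_square])
  then show ?case by (simp only: distrib_left)
qed (simp add: zero)

lemma sum_of_squares_sum:
  "(\<And>i. i \<in> A \<Longrightarrow> sum_of_squares (f i)) \<Longrightarrow> sum_of_squares (\<Sum>i\<in>A. f i)"
  by (induction A rule: infinite_finite_induct) (simp_all add: zero sum_of_squares_add)

lemma sum_of_squares_abs_square: "sum_of_squares (z * star z)"
proof -
  have "z * star z = re_part (z * star z)"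
    by (simp add: re_part_def star_mult star_star flip: scaleR_2)
  also have "\<dots> = re_part z * re_part z + im_part z * im_part z"
    by (rule re_part_mult_star)
  finally show ?thesis
    using sum_of_squares_add sum_of_squares_square re_part_self_adjoint im_part_self_adjoint
    by metis
qed

lemma sum_of_squares_of_real:
  assumes "r \<ge> 0" shows "sum_of_squares (of_real r)"
  using sum_of_squares_square[of "of_real (sqrt r)"] assms by (simp flip: of_real_mult)

text \<open>
  An element $a$ of the positive cone satisfies $\|T-a\|\le T$ for large $T$. For a
  square the weaker bound with an error that tends to 0 as $T\to\infty$ has a direct proof: the
  element $T-h^2$ is the real part of $w=T-h^2+i\sqrt{2T}\,h$, a truncation of the series of
  $T\exp(i\sqrt{2/T}\,h)$, which is $T$ times a unitary. The coefficients are chosen so that the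
  terms $\pm2Th^2$ of $w^*w$ cancel.
\<close>

lemma norm_shift_square_le:
  fixes h :: "'a::comm_cstar_algebra"
  assumes h: "h \<in> self_adjoint" and T: "T > 0"
  shows "norm (of_real T - h * h) \<le> T + norm h ^ 4 / T"
proof -
  define w where "w = (of_real T - h * h) + imag_unit * (of_real (sqrt (2 * T)) * h)"
  have sw: "star w = (of_real T - h * h) - imag_unit * (of_real (sqrt (2 * T)) * h)"
    using h by (simp add: w_def star_add star_diff star_mult star_imag_unit self_adjointD mult.commute)
  have "w + star w = (of_real T - h * h) + (of_real T - h * h)"
    by (subst sw) (simp add: w_def)
  then have re: "of_real T - h * h = (1/2) *\<^sub>R (w + star w)"
    unfolding scaleR_2[symmetric] by simp
  have "star w * w = (of_real T - h * h) * (of_real T - h * h)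
      - (imag_unit * imag_unit) * ((of_real (sqrt (2 * T)) * of_real (sqrt (2 * T))) * (h * h))"
    by (subst sw) (simp add: w_def algebra_simps)
  also have "of_real (sqrt (2 * T)) * of_real (sqrt (2 * T)) = (of_real (2 * T) :: 'a)"
    using T by (simp flip: of_real_mult)
  finally have "star w * w = of_real (T\<^sup>2) + h ^ 4"
    by (simp add: imag_unit_square algebra_simps power2_eq_square power4_eq_xxxx)
  then have "(norm w)\<^sup>2 = norm (of_real (T\<^sup>2) + h ^ 4)"
    by (simp flip: cstar_identity)
  also have "\<dots> \<le> T\<^sup>2 + norm h ^ 4"
    using norm_triangle_ineq[of "of_real (T\<^sup>2)" "h ^ 4"] norm_power_ineq[of h 4]
    by (simp add: norm_of_real del: of_real_power)
  also have "\<dots> \<le> (T + norm h ^ 4 / T)\<^sup>2"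
    using T by (simp add: power2_sum)
  finally have "norm w \<le> T + norm h ^ 4 / T"
    using T by (auto elim!: power2_le_imp_le)
  moreover have "norm (of_real T - h * h) \<le> norm w"
    unfolding re using norm_triangle_ineq[of w "star w"] by (simp add: norm_star)
  ultimately show ?thesis by simp
qed

text \<open>
  The bound is stable under addition, because $T$ can be shared evenly between two summands.
\<close>

lemma norm_shift_sum_of_squares_le:
  assumes "sum_of_squares a"
  shows "\<exists>C\<ge>0. \<forall>T>0. norm (of_real T - a) \<le> T + C / T"
  using assms
proof (induction rule: sum_of_squares.induct)
  case zero
  then show ?case by (auto intro!: exI[of _ 0])
next
  case (add_square a h)
  then obtain C where C: "C \<ge> 0" "\<And>T. T > 0 \<Longrightarrow> norm (of_real T - a) \<le> T + C / T" by blast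
  have "norm (of_real T - (a + h * h)) \<le> T + (2 * C + 2 * norm h ^ 4) / T" if "T > 0" for T
  proof -
    have "of_real T - (a + h * h) = (of_real (T/2) - a) + (of_real (T/2) - h * h)"
    proof -
      have "of_real T = (of_real (T/2) + of_real (T/2) :: 'a)"
        by (simp flip: of_real_add)
      then show ?thesis by simp
    qed
    then have "norm (of_real T - (a + h * h))
        \<le> norm (of_real (T/2) - a) + norm (of_real (T/2) - h * h)"
      by (metis norm_triangle_ineq)
    also have "\<dots> \<le> (T/2 + C / (T/2)) + (T/2 + norm h ^ 4 / (T/2))"
      using that add_square C(2)[of "T/2"] norm_shift_square_le[of h "T/2"] by auto
    also have "\<dots> = T + (2 * C + 2 * norm h ^ 4) / T"
      using that by (simp add: field_simps)
    finally show ?thesis .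
  qed
  then show ?case using C(1) by (intro exI[of _ "2 * C + 2 * norm h ^ 4"]) auto
qed

lemma invertible_if_norm_less_one:
  fixes y :: "'a::{real_normed_algebra_1, banach, comm_ring_1}"
  assumes "norm y < 1"
  shows "\<exists>b. (1 - y) * b = 1"
proof -
  have s: "summable (\<lambda>m. y ^ m)" using assms by (rule complete_algebra_summable_geometric)
  have "(\<Sum>m. y ^ m) = 1 + y * (\<Sum>m. y ^ m)"
    using suminf_split_head[OF s] suminf_mult[OF s, of y] by simp
  then show ?thesis by (intro exI[of _ "\<Sum>m. y ^ m"]) (simp add: algebra_simps)
qed

text \<open>
  With $b$ near $a$, the element $a+r=(T+r)-(T-a)$ is inverted by a Neumann series as soon as
  $\|T-a\|<T+r$. The error $C/T$ from the preceding bound fits into the gap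
  $r-\|a-b\|$ once $T$ is large. Taking $b=a$ inverts any positive shift of a sum of
  squares.
\<close>

lemma invertible_if_near_sum_of_squares:
  fixes a b :: "'a::comm_cstar_algebra"
  assumes b: "sum_of_squares b" and near: "norm (a - b) < r"
  shows "\<exists>c. (a + of_real r) * c = 1"
proof -
  obtain C where C: "C \<ge> 0" "\<And>T. T > 0 \<Longrightarrow> norm (of_real T - b) \<le> T + C / T"
    using norm_shift_sum_of_squares_le[OF b] by blast
  define g where "g = r - norm (a - b)"
  have g: "g > 0" using near by (simp add: g_def)
  define T where "T = (C + 1) / g"
  have T: "T > 0" "C / T < g" using C(1) g by (auto simp: T_def field_simps)
  have r: "r > 0" using near norm_ge_zero[of "a - b"] by linarith
  define y where "y = (1 / (T + r)) *\<^sub>R (of_real T - a)"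
  have "norm (of_real T - a) \<le> norm (of_real T - b) + norm (a - b)"
    using norm_triangle_ineq4[of "of_real T - b" "a - b"] by simp
  also have "\<dots> < T + r"
    using C(2)[OF T(1)] T(2) by (simp add: g_def)
  finally have "norm (of_real T - a) / (T + r) < 1" using T(1) r by simp
  then have "norm y < 1" using T(1) r by (simp add: y_def)
  then obtain c where c: "(1 - y) * c = 1" using invertible_if_norm_less_one by blast
  have "(T + r) *\<^sub>R y = of_real T - a"
    using T(1) r by (simp add: y_def)
  then have "a + of_real r = (T + r) *\<^sub>R (1 - y)"
    by (simp add: scaleR_diff_right scaleR_left_distrib of_real_def)
  then have "(a + of_real r) * ((1 / (T + r)) *\<^sub>R c) = 1"
    using T(1) r c by simp
  then show ?thesis by blast
qed

text \<open>
  For negative real $z$ the inverse of $a-z$ comes from a sum of squares at distance less than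
  $-z$. For nonreal $z$ it comes from factoring the sum of squares
  $(a-\mathrm{Re}\,z)^2+(\mathrm{Im}\,z)^2=(a-z)(a-\bar z)$.
\<close>

lemma cstar_nonneg_if_limit_of_sums_of_squares:
  fixes a :: "'a::comm_cstar_algebra"
  assumes a: "a \<in> self_adjoint"
    and lim: "\<And>r. r > 0 \<Longrightarrow> \<exists>b. sum_of_squares b \<and> norm (a - b) < r"
  shows "cstar_nonneg a"
proof -
  have "z \<in> complex_of_real ` {0..}" if z: "z \<in> alg_spectrum a" for z
  proof (rule ccontr)
    assume not: "z \<notin> complex_of_real ` {0..}"
    have decomp: "z *\<^sub>C (1::'a) = of_real (Re z) + imag_unit * of_real (Im z)"
    proof -
      have "z *\<^sub>C (1::'a) = (complex_of_real (Re z) + complex_of_real (Im z) * \<i>) *\<^sub>C 1"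
        by (rule arg_cong[where f = "\<lambda>u. u *\<^sub>C 1"]) (simp add: complex_eq_iff)
      also have "\<dots> = of_real (Re z) + of_real (Im z) * imag_unit"
        unfolding scaleC_add_left scaleC_scaleC[symmetric] imag_unit_def
        unfolding scaleR_scaleC[symmetric] of_real_def[where 'a = 'a] by simp
      finally show ?thesis by (simp add: mult.commute)
    qed
    have "\<exists>c. (a - z *\<^sub>C 1) * c = 1"
    proof (cases "Im z = 0")
      case True
      have "Re z < 0"
      proof (rule ccontr)
        assume "\<not> Re z < 0"
        moreover have "z = complex_of_real (Re z)" using True by (simp add: complex_eq_iff)
        ultimately show False using not by auto
      qed
      then obtain b where "sum_of_squares b" "norm (a - b) < - Re z" using lim[of "- Re z"] by auto
      from invertible_if_near_sum_of_squares[OF this] show ?thesis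
        by (simp add: decomp True)
    next
      case False
      define h where "h = a - of_real (Re z)"
      have h: "h \<in> self_adjoint" using a by (simp add: h_def)
      have "\<exists>c. (h * h + of_real ((Im z)\<^sup>2)) * c = 1"
        by (rule invertible_if_near_sum_of_squares[OF sum_of_squares_square[OF h]])
          (use False in simp)
      moreover have "h * h + of_real ((Im z)\<^sup>2)
          = (a - z *\<^sub>C 1) * (h + imag_unit * of_real (Im z))"
      proof -
        have "(a - z *\<^sub>C 1) * (h + imag_unit * of_real (Im z))
            = h * h - (imag_unit * imag_unit) * (of_real (Im z) * of_real (Im z))"
          by (simp add: decomp h_def algebra_simps)
        then show ?thesis by (simp add: imag_unit_square power2_eq_square)
      qed
      ultimately show ?thesis by (metis mult.assoc)
    qed
    then show False using z by (auto simp: alg_spectrum_def mult.commute)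
  qed
  then show ?thesis using a by (auto simp: cstar_nonneg_def)
qed

section \<open>Gram kernels\<close>

text \<open>
  Kernels $\langle u_j,u_k\rangle$ of vectors with finitely many self-adjoint coordinates, built
  up one coordinate at a time. This avoids naming the coordinates: products and projections
  change their number.
\<close>

inductive gram_kernel :: "('i \<Rightarrow> 'i \<Rightarrow> 'a::comm_cstar_algebra) \<Rightarrow> bool" where
  zero: "gram_kernel (\<lambda>j k. 0)"
| add_rank_one: "gram_kernel K \<Longrightarrow> (\<And>j. f j \<in> self_adjoint) \<Longrightarrow>
    gram_kernel (\<lambda>j k. K j k + f j * f k)"

lemma gram_kernel_rank_one:
  "(\<And>j. f j \<in> self_adjoint) \<Longrightarrow> gram_kernel (\<lambda>j k. f j * f k)"
  using gram_kernel.add_rank_one[OF gram_kernel.zero, of f] by simp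

lemma gram_kernel_sym: "gram_kernel K \<Longrightarrow> K j k = K k j"
  by (induction rule: gram_kernel.induct) (auto simp: mult.commute)

lemma gram_kernel_self_adjoint: "gram_kernel K \<Longrightarrow> K j k \<in> self_adjoint"
  by (induction rule: gram_kernel.induct) auto

lemma gram_kernel_diag: "gram_kernel K \<Longrightarrow> sum_of_squares (K j j)"
  by (induction rule: gram_kernel.induct) (auto intro: sum_of_squares.intros)

lemma gram_kernel_mult_rank_one:
  assumes "gram_kernel K" and f: "\<And>j. f j \<in> self_adjoint"
  shows "gram_kernel (\<lambda>j k. K j k * (f j * f k))"
  using assms(1)
proof (induction rule: gram_kernel.induct)
  case (add_rank_one K g)
  have "gram_kernel (\<lambda>j k. K j k * (f j * f k) + (g j * f j) * (g k * f k))"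
    using add_rank_one f by (intro gram_kernel.add_rank_one) auto
  moreover have "(\<lambda>j k. (K j k + g j * g k) * (f j * f k))
      = (\<lambda>j k. K j k * (f j * f k) + (g j * f j) * (g k * f k))"
    by (auto simp: algebra_simps)
  ultimately show ?case by simp
qed (simp add: gram_kernel.zero)

lemma gram_kernel_add:
  assumes "gram_kernel K" and "gram_kernel L"
  shows "gram_kernel (\<lambda>j k. K j k + L j k)"
  using assms(2)
proof (induction rule: gram_kernel.induct)
  case (add_rank_one L f)
  then show ?case
    using gram_kernel.add_rank_one[of "\<lambda>j k. K j k + L j k" f] by (simp add: add.assoc)
qed (use assms(1) in simp)

lemma gram_kernel_mult:
  assumes "gram_kernel K" and "gram_kernel L"
  shows "gram_kernel (\<lambda>j k. K j k * L j k)"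
  using assms(2)
proof (induction rule: gram_kernel.induct)
  case (add_rank_one L f)
  then show ?case
    using gram_kernel_add[OF add_rank_one.IH gram_kernel_mult_rank_one[OF assms(1), of f]]
    by (simp add: distrib_left)
qed (simp add: gram_kernel.zero)

lemma gram_kernel_prod:
  fixes d :: nat
  assumes "\<And>l. l < d \<Longrightarrow> gram_kernel (K l)"
  shows "gram_kernel (\<lambda>j k. \<Prod>l<d. K l j k)"
  using assms
proof (induction d)
  case 0
  show ?case using gram_kernel_rank_one[of "\<lambda>_. 1"] by simp
next
  case (Suc d)
  then show ?case using gram_kernel_mult[of "\<lambda>j k. \<Prod>l<d. K l j k" "K d"] by simp
qed

text \<open>
  The kernel of the vectors $u_j-a_ju_m$, when $K$ is that of the vectors $u_j$.
\<close>

lemma gram_kernel_project: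
  assumes "gram_kernel K" and a: "\<And>j. a j \<in> self_adjoint"
  shows "gram_kernel (\<lambda>j k. K j k - a j * K m k - a k * K j m + a j * a k * K m m)"
  using assms(1)
proof (induction rule: gram_kernel.induct)
  case (add_rank_one K f)
  have "gram_kernel (\<lambda>j k. (K j k - a j * K m k - a k * K j m + a j * a k * K m m)
      + (f j - a j * f m) * (f k - a k * f m))"
    using add_rank_one a by (intro gram_kernel.add_rank_one) auto
  moreover have "(\<lambda>j k. K j k + f j * f k - a j * (K m k + f m * f k)
        - a k * (K j m + f j * f m) + a j * a k * (K m m + f m * f m))
      = (\<lambda>j k. (K j k - a j * K m k - a k * K j m + a j * a k * K m m)
      + (f j - a j * f m) * (f k - a k * f m))"
    by (auto simp: algebra_simps)
  ultimately show ?case by simp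
qed (simp add: gram_kernel.zero)

text \<open>
  The inverse $b$ of a sum of squares $s$ is one itself, since $b=sb^2$ with $b$ self-adjoint.
\<close>

lemma invertible_gram_diag:
  assumes "gram_kernel K" and "e > 0"
  obtains b where "(K m m + of_real e) * b = 1" and "sum_of_squares b"
proof -
  let ?s = "K m m + of_real e"
  have s: "sum_of_squares ?s"
    using assms(2)
    by (intro sum_of_squares_add[OF _ gram_kernel_diag[OF assms(1)]] sum_of_squares_of_real) simp
  obtain b where b: "?s * b = 1"
    using invertible_if_near_sum_of_squares[OF gram_kernel_diag[OF assms(1)], of "K m m" m e] assms(2)
    by auto
  \<comment> \<open>Inverses are unique, so the inverse of a self-adjoint element is self-adjoint.\<close>
  have sb: "?s * star b = 1"
  proof -
    have "star (?s * b) = 1" by (simp add: b)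
    then show ?thesis
      by (simp add: star_mult self_adjointD[OF sum_of_squares_self_adjoint[OF s]] mult.commute)
  qed
  have "star b = star b * (?s * b)" by (simp add: b)
  also have "\<dots> = (?s * star b) * b" by (simp only: mult_ac)
  finally have "b \<in> self_adjoint" by (simp add: sb self_adjoint_def)
  then have "sum_of_squares (?s * (b * b))" by (rule sum_of_squares_mult_square[OF s])
  then have "sum_of_squares b" by (simp add: b flip: mult.assoc)
  then show ?thesis using that b by blast
qed

text \<open>
  The decomposition $K+eI=WDW^T$ with $D$ diagonal, its entries \<open>r p\<close> being sums of
  squares: they are the inverses of the pivots.

  The induction eliminates the last index $n$ with pivot $s=K_{nn}+e$ and $b=s^{-1}$. It rests
  on the Schur complement $L$ being a Gram kernel again. With $a_j=bK_{jn}$ the kernel of the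
  vectors $u_j-a_ju_n$ is $K_{jk}-bK_{jn}K_{kn}-e\,a_ja_k$: because of the shift $e$ in the
  pivot this is not yet the Schur complement, and the extra coordinate $\sqrt e\,a_j$ makes up
  for the difference.
\<close>

lemma gram_kernel_LDL:
  fixes K :: "nat \<Rightarrow> nat \<Rightarrow> 'a::comm_cstar_algebra"
  assumes "gram_kernel K" and e: "e > 0"
  obtains r :: "nat \<Rightarrow> 'a" and w :: "nat \<Rightarrow> nat \<Rightarrow> 'a"
  where "\<And>p. sum_of_squares (r p)" and "\<And>j p. w j p \<in> self_adjoint"
    and "\<And>j k. j < n \<Longrightarrow> k < n \<Longrightarrow>
      K j k + of_real (if j = k then e else 0) = (\<Sum>p<n. r p * w j p * w k p)"
proof -
  have "\<exists>r w. (\<forall>p. sum_of_squares (r p)) \<and> (\<forall>j p. w j p \<in> self_adjoint) \<and>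
      (\<forall>j<n. \<forall>k<n. K j k + of_real (if j = k then e else 0) = (\<Sum>p<n. r p * w j p * w k p))"
    using assms(1)
  proof (induction n arbitrary: K)
    case 0
    show ?case by (auto intro!: exI[of _ "\<lambda>_. 0"] exI[of _ "\<lambda>_ _. 0"] sum_of_squares.zero)
  next
    case (Suc n)
    note K = Suc.prems
    obtain b where b: "(K n n + of_real e) * b = 1" and sb: "sum_of_squares b"
      using invertible_gram_diag[OF K e] by blast
    have sab: "b \<in> self_adjoint" by (rule sum_of_squares_self_adjoint[OF sb])
    have saK: "K j k \<in> self_adjoint" for j k by (rule gram_kernel_self_adjoint[OF K])
    define a where "a j = b * K j n" for j
    define L where "L j k = (K j k - a j * K n k - a k * K j n + a j * a k * K n n)
        + (of_real (sqrt e) * a j) * (of_real (sqrt e) * a k)" for j k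
    have "gram_kernel L"
      unfolding L_def using sab saK
      by (intro gram_kernel.add_rank_one gram_kernel_project K) (auto simp: a_def)
    have L: "L j k = K j k - b * K j n * K k n" for j k
    proof -
      have "L j k = K j k - a j * K k n - a k * K j n
          + a j * a k * (K n n + of_real (sqrt e) * of_real (sqrt e))"
        unfolding L_def gram_kernel_sym[OF K, of n k] by (simp add: algebra_simps)
      also have "of_real (sqrt e) * of_real (sqrt e) = (of_real e :: 'a)"
        using e by (simp flip: of_real_mult)
      also have "a j * a k * (K n n + of_real e) = b * K j n * K k n * ((K n n + of_real e) * b)"
        by (simp only: a_def mult_ac)
      finally have "L j k = K j k - a j * K k n - a k * K j n
          + b * K j n * K k n * ((K n n + of_real e) * b)" .
      then show ?thesis unfolding b by (simp add: a_def mult_ac)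
    qed
    obtain r w where r: "\<And>p. sum_of_squares (r p)" and w: "\<And>j p. w j p \<in> self_adjoint"
      and rw: "\<And>j k. j < n \<Longrightarrow> k < n \<Longrightarrow>
        L j k + of_real (if j = k then e else 0) = (\<Sum>p<n. r p * w j p * w k p)"
      using Suc.IH[OF \<open>gram_kernel L\<close>] by blast
    define r' where "r' p = (if p = n then b else r p)" for p
    define w' where "w' j p = (if p = n then K j n + of_real (if j = n then e else 0)
        else if j = n then 0 else w j p)" for j p
    have sum': "(\<Sum>p<Suc n. r' p * w' j p * w' k p)
        = (if j = n \<or> k = n then 0 else (\<Sum>p<n. r p * w j p * w k p))
          + b * w' j n * w' k n" for j k
      by (auto simp: r'_def w'_def intro!: sum.neutral)
    have "K j k + of_real (if j = k then e else 0) = (\<Sum>p<Suc n. r' p * w' j p * w' k p)"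
      if jk: "j < Suc n" "k < Suc n" for j k
    proof -
      \<comment> \<open>In row and column \<open>n\<close> only the new term survives: it is the pivot times its inverse.\<close>
      consider "j < n" "k < n" | "j = n" | "j < n" "k = n" using jk by linarith
      then show ?thesis
      proof cases
        case 1
        then show ?thesis
          unfolding sum' using rw[OF 1] by (simp add: w'_def L algebra_simps)
      next
        case 2
        have "b * w' n n * w' k n = ((K n n + of_real e) * b) * w' k n"
          by (simp add: w'_def mult_ac)
        then show ?thesis
          unfolding sum' using 2 b gram_kernel_sym[OF K, of n k] by (simp add: w'_def)
      next
        case 3
        have "b * w' j n * w' n n = ((K n n + of_real e) * b) * w' j n"
          by (simp add: w'_def mult_ac)
        then show ?thesis
          unfolding sum' using 3 b by (simp add: w'_def)
      qed
    qed
    moreover have "\<forall>p. sum_of_squares (r' p)" using r sb by (simp add: r'_def)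
    moreover have "\<forall>j p. w' j p \<in> self_adjoint" using w saK by (simp add: w'_def)
    ultimately show ?case by blast
  qed
  then show ?thesis using that by blast
qed

section \<open>The Schur square of a positive kernel\<close>

text \<open>
  The inequality $|\sum_p y_p|^2\le n\sum_p|y_p|^2$ with an explicit sum of squares for the
  difference: divided by $n$, it is the sum of the squared deviations from the mean.
\<close>

lemma variance_sum_of_squares:
  fixes y :: "nat \<Rightarrow> 'a::comm_cstar_algebra"
  assumes "n > 0"
  shows "sum_of_squares ((\<Sum>p<n. y p * star (y p))
    - (1 / real n) *\<^sub>R ((\<Sum>p<n. y p) * star (\<Sum>p<n. y p)))"
proof -
  define Y where "Y = (\<Sum>p<n. y p)"
  define m where "m = (1 / real n) *\<^sub>R Y"
  have Y: "Y = real n *\<^sub>R m" using assms by (simp add: m_def)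
  have "(\<Sum>p<n. (y p - m) * star (y p - m))
      = (\<Sum>p<n. y p * star (y p)) - Y * star m - m * star Y + real n *\<^sub>R (m * star m)"
    unfolding Y_def
    by (simp add: star_diff star_sum algebra_simps sum.distrib sum_subtractf sum_distrib_left
        sum_distrib_right scaleR_conv_of_real)
  also have "\<dots> = (\<Sum>p<n. y p * star (y p)) - (1 / real n) *\<^sub>R (Y * star Y)"
    using assms unfolding Y by (simp add: star_scaleR)
  finally have "(\<Sum>p<n. y p * star (y p)) - (1 / real n) *\<^sub>R (Y * star Y)
      = (\<Sum>p<n. (y p - m) * star (y p - m))"
    by (rule sym)
  moreover have "sum_of_squares (\<Sum>p<n. (y p - m) * star (y p - m))"
    by (intro sum_of_squares_sum sum_of_squares_abs_square)
  ultimately show ?thesis unfolding Y_def by (rule ssubst)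
qed

text \<open>
  The trace inequality for $T_{pq}=\sum_jc_jw_{jp}w_{jq}$. In the metric given by the weights
  \<open>r p\<close>, the quadratic form is the Hilbert-Schmidt norm $\sum_{p,q}r_pr_q|T_{pq}|^2$ and the linear
  term is the trace $\sum_pr_pT_{pp}$. The off-diagonal part of the norm is a sum of squares, and the
  diagonal part dominates the trace by the variance identity. The factor $1/n$ appears because
  there are only $n$ indices $p$.
\<close>

lemma schur_square_form_sum_of_squares:
  fixes c :: "nat \<Rightarrow> 'a::comm_cstar_algebra"
  assumes "n > 0"
    and r: "\<And>p. sum_of_squares (r p)"
    and w: "\<And>j p. w j p \<in> self_adjoint"
    and M: "\<And>j k. j < n \<Longrightarrow> k < n \<Longrightarrow> M j k = (\<Sum>p<n. r p * w j p * w k p)"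
  shows "sum_of_squares ((\<Sum>j<n. \<Sum>k<n. M j k * M j k * (c j * star (c k)))
    - (1 / real n) *\<^sub>R ((\<Sum>j<n. M j j * c j) * star (\<Sum>j<n. M j j * c j)))"
proof -
  define T where "T p q = (\<Sum>j<n. c j * w j p * w j q)" for p q
  have sr: "star (r p) = r p" for p by (rule self_adjointD[OF sum_of_squares_self_adjoint[OF r]])
  have sw: "star (w j p) = w j p" for j p by (rule self_adjointD[OF w])
  have sT: "star (T p q) = (\<Sum>k<n. star (c k) * w k p * w k q)" for p q
    by (simp add: T_def star_sum star_mult sw mult_ac)
  \<comment> \<open>Expand both factors \<open>M j k\<close> and move the summations over \<open>p\<close> and \<open>q\<close> outwards.\<close>
  have "(\<Sum>j<n. \<Sum>k<n. M j k * M j k * (c j * star (c k)))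
      = (\<Sum>j<n. \<Sum>k<n. \<Sum>p<n. \<Sum>q<n.
          (r p * w j p * w k p) * (r q * w j q * w k q) * (c j * star (c k)))"
    by (intro sum.cong refl) (simp only: lessThan_iff M, simp only: sum_product, simp only: sum_distrib_right)
  also have "\<dots> = (\<Sum>j<n. \<Sum>p<n. \<Sum>k<n. \<Sum>q<n.
          (r p * w j p * w k p) * (r q * w j q * w k q) * (c j * star (c k)))"
    by (intro sum.cong refl sum.swap)
  also have "\<dots> = (\<Sum>p<n. \<Sum>j<n. \<Sum>k<n. \<Sum>q<n.
          (r p * w j p * w k p) * (r q * w j q * w k q) * (c j * star (c k)))"
    by (rule sum.swap)
  also have "\<dots> = (\<Sum>p<n. \<Sum>j<n. \<Sum>q<n. \<Sum>k<n.
          (r p * w j p * w k p) * (r q * w j q * w k q) * (c j * star (c k)))"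
    by (intro sum.cong refl sum.swap)
  also have "\<dots> = (\<Sum>p<n. \<Sum>q<n. \<Sum>j<n. \<Sum>k<n.
          (r p * w j p * w k p) * (r q * w j q * w k q) * (c j * star (c k)))"
    by (intro sum.cong refl sum.swap)
  also have "\<dots> = (\<Sum>p<n. \<Sum>q<n. r p * r q * (T p q * star (T p q)))"
    unfolding sT unfolding T_def
    by (intro sum.cong refl) (simp only: sum_product, simp add: sum_distrib_left mult_ac)
  also have "\<dots> = (\<Sum>p<n. (\<Sum>q\<in>{..<n} - {p}. r p * r q * (T p q * star (T p q)))
      + (r p * T p p) * star (r p * T p p))"
    by (intro sum.cong refl) (simp add: sum.remove star_mult sr mult_ac)
  finally have form: "(\<Sum>j<n. \<Sum>k<n. M j k * M j k * (c j * star (c k)))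
      = (\<Sum>p<n. \<Sum>q\<in>{..<n} - {p}. r p * r q * (T p q * star (T p q)))
        + (\<Sum>p<n. (r p * T p p) * star (r p * T p p))"
    by (simp add: sum.distrib)
  have "(\<Sum>j<n. M j j * c j) = (\<Sum>j<n. \<Sum>p<n. r p * (c j * w j p * w j p))"
    by (intro sum.cong refl) (simp add: M sum_distrib_left mult_ac)
  also have "\<dots> = (\<Sum>p<n. \<Sum>j<n. r p * (c j * w j p * w j p))"
    by (rule sum.swap)
  also have "\<dots> = (\<Sum>p<n. r p * T p p)"
    by (simp add: T_def sum_distrib_left)
  finally have trace: "(\<Sum>j<n. M j j * c j) = (\<Sum>p<n. r p * T p p)" .
  have "sum_of_squares (\<Sum>p<n. \<Sum>q\<in>{..<n} - {p}. r p * r q * (T p q * star (T p q)))"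
    by (intro sum_of_squares_sum sum_of_squares_mult sum_of_squares_abs_square r)
  from sum_of_squares_add[OF variance_sum_of_squares[OF assms(1), of "\<lambda>p. r p * T p p"] this]
  show ?thesis unfolding form trace by (simp add: add_diff_eq)
qed

text \<open>
  The form depends polynomially on the diagonal shift $e$, so the sums of squares that it equals for
  $e>0$ converge to its value at $e=0$.
\<close>

lemma schur_square_form_nonneg:
  fixes c :: "nat \<Rightarrow> 'a::comm_cstar_algebra"
  assumes n: "n > 0" and K: "gram_kernel K"
  shows "cstar_nonneg ((\<Sum>j<n. \<Sum>k<n. K j k * K j k * (c j * star (c k)))
    - (1 / real n) *\<^sub>R ((\<Sum>j<n. K j j * c j) * star (\<Sum>j<n. K j j * c j)))"
proof -
  define M where "M e j k = K j k + of_real (if j = k then e else 0)" for e j k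
  define Q where "Q e = (\<Sum>j<n. \<Sum>k<n. M e j k * M e j k * (c j * star (c k)))
    - (1 / real n) *\<^sub>R ((\<Sum>j<n. M e j j * c j) * star (\<Sum>j<n. M e j j * c j))" for e
  have M0: "M 0 j k = K j k" for j k by (simp add: M_def)
  have sos: "sum_of_squares (Q e)" if e: "e > 0" for e
  proof -
    obtain r w where "\<And>p. sum_of_squares (r p)" "\<And>j p. w j p \<in> self_adjoint"
      "\<And>j k. j < n \<Longrightarrow> k < n \<Longrightarrow> M e j k = (\<Sum>p<n. r p * w j p * w k p)"
      unfolding M_def using gram_kernel_LDL[OF K e, of n] by metis
    then show ?thesis unfolding Q_def by (rule schur_square_form_sum_of_squares[OF n])
  qed
  have saM: "star (M e j k) = M e j k" for e j k
    unfolding M_def by (intro self_adjointD self_adjoint_intros gram_kernel_self_adjoint[OF K])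
  have Q: "Q = (\<lambda>e. (\<Sum>j<n. \<Sum>k<n. M e j k * M e j k * (c j * star (c k)))
    - (1 / real n) *\<^sub>R ((\<Sum>j<n. M e j j * c j) * (\<Sum>j<n. M e j j * star (c j))))"
    by (auto simp: Q_def star_sum star_mult saM mult.commute)
  have tM: "((\<lambda>e. M e j k) \<longlongrightarrow> K j k) (at_right 0)" for j k
  proof (cases "j = k")
    case True
    have "((\<lambda>e. K j k + of_real e) \<longlongrightarrow> K j k + of_real 0) (at_right 0)"
      by (intro tendsto_intros)
    then show ?thesis using True by (simp add: M_def)
  qed (simp add: M_def)
  have lim: "(Q \<longlongrightarrow> Q 0) (at_right 0)"
    unfolding Q M0 by (intro tendsto_intros tM)
  have "cstar_nonneg (Q 0)"
  proof (rule cstar_nonneg_if_limit_of_sums_of_squares)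
    have "star (Q 0) = (\<Sum>j<n. \<Sum>k<n. K j k * K j k * (c k * star (c j)))
      - (1 / real n) *\<^sub>R ((\<Sum>j<n. K j j * c j) * star (\<Sum>j<n. K j j * c j))"
      using saM[of 0] unfolding Q_def M0
      by (simp add: star_diff star_sum star_mult star_scaleR star_star mult.commute)
    also have "\<dots> = Q 0"
      unfolding Q_def M0 by (subst sum.swap) (simp add: gram_kernel_sym[OF K])
    finally show "Q 0 \<in> self_adjoint" by (simp add: self_adjoint_def)
  next
    fix r :: real assume r: "r > 0"
    have "\<forall>\<^sub>F e in at_right 0. dist (Q e) (Q 0) < r"
      using lim r by (simp add: tendsto_iff)
    moreover have "\<forall>\<^sub>F e in at_right 0. (e::real) > 0" by (rule eventually_at_right_less)
    ultimately have "\<forall>\<^sub>F e in at_right 0. dist (Q e) (Q 0) < r \<and> e > 0"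
      by (rule eventually_conj)
    then obtain e where "dist (Q e) (Q 0) < r" "e > 0"
      using eventually_happens' trivial_limit_at_right_real by blast
    then show "\<exists>b. sum_of_squares b \<and> norm (Q 0 - b) < r"
      using sos[of e] by (auto simp: dist_norm norm_minus_commute intro!: exI[of _ "Q e"])
  qed
  then show ?thesis unfolding Q_def M0 .
qed

section \<open>The cosine kernel\<close>

text \<open>
  The exponential $e^{ix/2}$; its real and imaginary parts are $\cos(x/2)$ and $\sin(x/2)$ for
  self-adjoint $x$.
\<close>

definition half_phase :: "'a::cstar_algebra \<Rightarrow> 'a" where
  "half_phase x = exp (imag_unit * ((1/2) *\<^sub>R x))"

lemma star_half_phase:
  fixes x :: "'a::comm_cstar_algebra"
  assumes "x \<in> self_adjoint"
  shows "star (half_phase x) = half_phase (- x)"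
  using assms
  by (simp add: half_phase_def star_exp star_mult star_imag_unit star_scaleR self_adjointD mult.commute)

lemma half_phase_add: "half_phase (x + y) = half_phase x * half_phase y"
  for x y :: "'a::comm_cstar_algebra"
  unfolding half_phase_def scaleR_add_right distrib_left
  by (rule exp_add_commuting) (rule mult.commute)

lemma half_phase_square: "half_phase x * half_phase x = exp (\<i> *\<^sub>C x)"
  for x :: "'a::cstar_algebra"
proof -
  have "half_phase x * half_phase x
      = exp (imag_unit * ((1/2) *\<^sub>R x) + imag_unit * ((1/2) *\<^sub>R x))"
    by (simp add: half_phase_def exp_add_commuting)
  also have "imag_unit * ((1/2) *\<^sub>R x) + imag_unit * ((1/2) *\<^sub>R x) = imag_unit * x"
    by (simp flip: distrib_left scaleR_left_distrib)
  finally show ?thesis by (simp add: scaleC_i)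
qed

text \<open>
  With $u=e^{i(x-y)/2}$ and $v=u^{-1}=u^*$ the left-hand side is $((u+v)/2)^2$ because
  $2+u^2+v^2=(u+v)^2$, and $(u+v)/2$ is the real part of the product of $e^{ix/2}$ with the
  adjoint of $e^{iy/2}$.
\<close>

lemma cos_half_angle:
  fixes x y :: "'a::comm_cstar_algebra"
  assumes x: "x \<in> self_adjoint" and y: "y \<in> self_adjoint"
  shows "(1/2) *\<^sub>R (1 + cstar_cos (x - y)) =
    (re_part (half_phase x) * re_part (half_phase y)
      + im_part (half_phase x) * im_part (half_phase y))\<^sup>2"
proof -
  define u where "u = half_phase (x - y)"
  define v where "v = half_phase (- (x - y))"
  have uv: "u * v = 1"
    unfolding u_def v_def half_phase_add[symmetric] by (simp add: half_phase_def)
  have v: "v = star u"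
    unfolding u_def v_def using star_half_phase[of "x - y"] x y by simp
  have "half_phase x * star (half_phase y) = u"
    using half_phase_add[of x "- y"] star_half_phase[OF y] by (simp add: u_def)
  then have r: "re_part (half_phase x) * re_part (half_phase y)
      + im_part (half_phase x) * im_part (half_phase y) = (1/2) *\<^sub>R (u + v)"
    unfolding re_part_mult_star[symmetric] by (simp add: re_part_def v)
  have halves: "(1/2) *\<^sub>R z + (1/2) *\<^sub>R z = z" for z :: 'a
    by (simp flip: scaleR_left_distrib)
  have "exp (\<i> *\<^sub>C (x - y)) = u * u" and "exp (- (\<i> *\<^sub>C (x - y))) = v * v"
    unfolding u_def v_def half_phase_square by (simp_all add: scaleC_i algebra_simps)
  then have "(1/2) *\<^sub>R (1 + cstar_cos (x - y))
      = (1/2) *\<^sub>R (u * v + (1/2) *\<^sub>R (u * u + v * v))"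
    by (simp add: cstar_cos_def uv)
  also have "\<dots> = ((1/2) *\<^sub>R (u + v))\<^sup>2"
    using halves[of "(1/2) *\<^sub>R (u * v)"] by (simp add: power2_eq_square algebra_simps)
  finally show ?thesis unfolding r .
qed

theorem theorem4p4:
  fixes n d :: nat and x :: "nat \<Rightarrow> nat \<Rightarrow> 'a::comm_cstar_algebra"
  assumes "n \<ge> 2" and "d \<ge> 2"
    and "\<And>j l. j < n \<Longrightarrow> l < d \<Longrightarrow> x j l \<in> self_adjoint"
  shows "positive_mat n (mat n n (\<lambda>(j, k).
           (\<Prod>l<d. (1/2) *\<^sub>R (1 + cstar_cos (x j l - x k l))) - of_real (1 / real n)))"
proof -
  have n: "n > 0" using assms(1) by simp
  define E where "E j l = half_phase (x j l)" for j l
  define K where "K j k = (\<Prod>l<d. re_part (E j l) * re_part (E k l)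
      + im_part (E j l) * im_part (E k l))" for j k
  have gram: "gram_kernel K"
    unfolding K_def
    by (intro gram_kernel_prod gram_kernel_add gram_kernel_rank_one
        re_part_self_adjoint im_part_self_adjoint)
  have entry: "(\<Prod>l<d. (1/2) *\<^sub>R (1 + cstar_cos (x j l - x k l))) = K j k * K j k"
    if "j < n" "k < n" for j k
  proof -
    have "(\<Prod>l<d. (1/2) *\<^sub>R (1 + cstar_cos (x j l - x k l)))
        = (\<Prod>l<d. (re_part (E j l) * re_part (E k l) + im_part (E j l) * im_part (E k l))\<^sup>2)"
      unfolding E_def using that assms(3) by (intro prod.cong refl cos_half_angle) auto
    then show ?thesis
      by (simp add: K_def power2_eq_square flip: prod.distrib)
  qed
  have diag: "K j j = 1" if "j < n" for j
  proof -
    have "E j l * star (E j l) = 1" if "l < d" for l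
      using star_half_phase[of "x j l"] half_phase_add[of "x j l" "- x j l"] assms(3) \<open>j < n\<close> that
      by (simp add: E_def half_phase_def)
    then have "re_part (E j l) * re_part (E j l) + im_part (E j l) * im_part (E j l) = 1"
      if "l < d" for l
      unfolding re_part_mult_star[symmetric] using that by (simp add: re_part_def flip: scaleR_2)
    then show ?thesis by (simp add: K_def)
  qed
  define A where "A = mat n n (\<lambda>(j, k).
    (\<Prod>l<d. (1/2) *\<^sub>R (1 + cstar_cos (x j l - x k l))) - of_real (1 / real n))"
  have A: "A = mat n n (\<lambda>(j, k). K j k * K j k - of_real (1 / real n))"
    unfolding A_def by (rule cong_mat) (auto simp: entry simp del: of_real_divide)
  have "mat_star A = A"
    unfolding A mat_star_def using gram_kernel_self_adjoint[OF gram] gram_kernel_sym[OF gram]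
    by (intro eq_matI) (simp_all add: star_diff star_mult self_adjointD del: of_real_divide)
  moreover have "cstar_nonneg (inner_vec (A *\<^sub>v v) v)" if "v \<in> carrier_vec n" for v
  proof -
    define c where "c j = v $ j" for j
    have "inner_vec (A *\<^sub>v v) v
        = (\<Sum>j<n. (\<Sum>k<n. (K j k * K j k - of_real (1 / real n)) * c k) * star (c j))"
      using that unfolding A inner_vec_def c_def
      by (auto simp: scalar_prod_def lessThan_atLeast0 simp del: of_real_divide intro!: sum.cong)
    also have "\<dots> = (\<Sum>j<n. \<Sum>k<n. K j k * K j k * (c k * star (c j)))
        - (1 / real n) *\<^sub>R (\<Sum>j<n. \<Sum>k<n. c k * star (c j))"
      by (simp add: sum_distrib_right sum_distrib_left sum_subtractf algebra_simps
          scaleR_conv_of_real del: of_real_divide)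
    also have "(\<Sum>j<n. \<Sum>k<n. c k * star (c j)) = (\<Sum>j<n. c j) * star (\<Sum>j<n. c j)"
      unfolding star_sum sum_product by (rule sum.swap)
    also have "(\<Sum>j<n. \<Sum>k<n. K j k * K j k * (c k * star (c j)))
        = (\<Sum>j<n. \<Sum>k<n. K j k * K j k * (c j * star (c k)))"
      by (subst sum.swap) (simp add: gram_kernel_sym[OF gram])
    \<comment> \<open>Reinserting the diagonal entries, all equal to 1, gives the form of the trace inequality.\<close>
    also have "(\<Sum>j<n. c j) = (\<Sum>j<n. K j j * c j)"
      by (simp add: diag)
    finally show ?thesis using schur_square_form_nonneg[OF n gram, of c] by simp
  qed
  ultimately have "positive_mat n A" by (simp add: positive_mat_def A_def)
  then show ?thesis by (simp only: A_def)
qed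

end
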